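(* Let $n \ge 2$. For any two distinct vertices $X$ and $Y$ of the polytope $\Omega_n$, the convex hull of $\{X, Y\}$ is an edge (a one-dimensional face) of $\Omega_n$.
   Context: Fix an integer $n \ge 2$. Consider the rational affine space $\mathbb{Q}^{4n^2}$ whose coordinates are indexed as $X_{ijpq}$ with $i,j \in \{1,\dots,n\}$ and $p,q \in \{1,2\}$. For each function $\rho:\{1,\dots,n\}\to\{1,2\}$ define the point $X^{\rho}$ by $X^{\rho}_{ijpq}=1$ if $p=\rho(i)$ and $q=\rho(j)$, and $X^{\rho}_{ijpq}=0$ otherwise. The polytope $\Omega_n \subset \mathbb{Q}^{4n^2}$ is the convex hull of all the points $X^{\rho}$. A face of a polytope $\Pi$ is either empty, $\Pi$ itself, or the intersection of $\Pi$ with a supporting hyperplane (a hyperplane one of whose closed half-spaces contains $\Pi$); an edge is a face of dimension $1$. *)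

theory Defs
  imports "HOL-Analysis.Cartesian_Space"
begin

text \<open>
  The library notions of convexity, faces and affine dimension live in real vector spaces.
  The polytope considered here lies in a rational space, so they are restated for
  \<open>rat ^ 'k\<close>, following the library's definitions where there is a real counterpart.
\<close>

definition rat_convex :: "(rat ^ 'k::finite) set \<Rightarrow> bool" where
  "rat_convex S \<longleftrightarrow>
     (\<forall>x\<in>S. \<forall>y\<in>S. \<forall>u\<ge>0. \<forall>v\<ge>0. u + v = 1 \<longrightarrow> u *s x + v *s y \<in> S)"

definition lin_form :: "rat ^ 'k::finite \<Rightarrow> rat ^ 'k \<Rightarrow> rat" where
  "lin_form c x = (\<Sum>k\<in>UNIV. c $ k * x $ k)"

text \<open>A supporting hyperplane is not required to meet \<open>P\<close>; it may also contain \<open>P\<close>.\<close>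

definition supporting_hyperplane :: "(rat ^ 'k::finite) set \<Rightarrow> (rat ^ 'k) set \<Rightarrow> bool" where
  "supporting_hyperplane P H \<longleftrightarrow>
     (\<exists>c b. c \<noteq> 0 \<and> H = {x. lin_form c x = b} \<and>
        (P \<subseteq> {x. lin_form c x \<le> b} \<or> P \<subseteq> {x. lin_form c x \<ge> b}))"

definition is_face :: "(rat ^ 'k::finite) set \<Rightarrow> (rat ^ 'k) set \<Rightarrow> bool" where
  "is_face P F \<longleftrightarrow> F = {} \<or> F = P \<or> (\<exists>H. supporting_hyperplane P H \<and> F = P \<inter> H)"

text \<open>The span of all differences is the direction space of the affine hull of \<open>S\<close>.\<close>

definition rat_aff_dim :: "(rat ^ 'k::finite) set \<Rightarrow> int" where
  "rat_aff_dim S =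
     (if S = {} then - 1 else int (vec.dim {x - y | x y. x \<in> S \<and> y \<in> S}))"

definition is_vertex :: "(rat ^ 'k::finite) set \<Rightarrow> rat ^ 'k \<Rightarrow> bool" where
  "is_vertex P x \<longleftrightarrow> is_face P {x}"

definition is_edge :: "(rat ^ 'k::finite) set \<Rightarrow> (rat ^ 'k) set \<Rightarrow> bool" where
  "is_edge P E \<longleftrightarrow> is_face P E \<and> rat_aff_dim E = 1"

text \<open>
  The type \<open>'n\<close> plays the role of \<open>{1,...,n}\<close> with \<open>n = CARD('n)\<close>, and the two-element
  numeral type \<open>2\<close> that of \<open>{1,2}\<close>; the index \<open>(i,j,p,q)\<close> addresses the coordinate
  \<open>X\<^sub>i\<^sub>j\<^sub>p\<^sub>q\<close>.
\<close>

definition omega_point :: "('n::finite \<Rightarrow> 2) \<Rightarrow> rat ^ ('n \<times> 'n \<times> 2 \<times> 2)" where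
  "omega_point \<rho> = (\<chi> k. case k of (i, j, p, q) \<Rightarrow> if p = \<rho> i \<and> q = \<rho> j then 1 else 0)"

definition Omega :: "(rat ^ ('n::finite \<times> 'n \<times> 2 \<times> 2)) set" where
  "Omega = rat_convex hull (range omega_point)"

end

theory Submission
  imports Defs
begin

text \<open>
  Let \<open>X\<close> and \<open>Y\<close> be the points of \<open>\<rho>\<close> and \<open>\<sigma>\<close>, and let \<open>c\<close> be the indicator of the
  coordinates on which both vanish. The form \<open>c\<close> is nonnegative on \<open>\<Omega>\<close>, and it vanishes
  at the point of \<open>\<tau>\<close> iff \<open>(\<tau> i, \<tau> j)\<close> is always \<open>(\<rho> i, \<rho> j)\<close> or \<open>(\<sigma> i, \<sigma> j)\<close>. If \<open>\<tau>\<close> differed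
  from \<open>\<rho>\<close> at \<open>i\<close> and from \<open>\<sigma>\<close> at \<open>j\<close>, the pair \<open>(i, j)\<close> would violate this; hence \<open>\<tau>\<close> is
  \<open>\<rho>\<close> or \<open>\<sigma>\<close>, and \<open>c = 0\<close> cuts out the segment from \<open>X\<close> to \<open>Y\<close>.
\<close>

lemma lin_form_combination:
  "lin_form c (u *s x + v *s y) = u * lin_form c x + v * lin_form c y"
  by (simp add: lin_form_def sum.distrib sum_distrib_left algebra_simps)

lemma lin_form_zero_left [simp]: "lin_form 0 x = 0"
  by (simp add: lin_form_def)

lemma lin_form_uminus_left: "lin_form (- c) x = - lin_form c x"
  by (simp add: lin_form_def sum_negf)

lemma rat_convexD:
  "rat_convex S \<Longrightarrow> x \<in> S \<Longrightarrow> y \<in> S \<Longrightarrow> 0 \<le> u \<Longrightarrow> 0 \<le> v \<Longrightarrow> u + v = 1 \<Longrightarrow> u *s x + v *s y \<in> S"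
  by (auto simp: rat_convex_def)

lemma rat_convex_hull: "rat_convex (rat_convex hull S)"
  by (rule hull_in) (fastforce simp: rat_convex_def)

text \<open>A convex combination of points satisfying the inequality attains equality only if every
  point of positive weight does. Hence the set \<open>T\<close> below is convex, and as it contains
  \<open>S\<close> it contains the whole hull.\<close>

lemma hull_Int_hyperplane:
  assumes "\<And>s. s \<in> S \<Longrightarrow> b \<le> lin_form c s"
  shows "rat_convex hull S \<inter> {x. lin_form c x = b} =
         rat_convex hull {s \<in> S. lin_form c s = b}" (is "_ = rat_convex hull ?F")
    and "rat_convex hull S \<subseteq> {x. b \<le> lin_form c x}"
proof -
  define T where "T = {x. b \<le> lin_form c x \<and> (lin_form c x = b \<longrightarrow> x \<in> rat_convex hull ?F)}"
  have "rat_convex T"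
    unfolding rat_convex_def
  proof (intro ballI allI impI)
    fix x y and u v :: rat
    assume T: "x \<in> T" "y \<in> T" and uv: "0 \<le> u" "0 \<le> v" "u + v = 1"
    have b: "b = u * b + v * b"
      using uv by (simp flip: distrib_right)
    have le: "u * b \<le> u * lin_form c x" "v * b \<le> v * lin_form c y"
      using T uv by (auto simp: T_def intro: mult_left_mono)
    have "u *s x + v *s y \<in> rat_convex hull ?F"
      if "u * lin_form c x + v * lin_form c y = b"
    proof -
      have eq: "u * lin_form c x = u * b" "v * lin_form c y = v * b"
        using that b le by linarith+
      \<comment> \<open>The equalities \<open>eq\<close> can be cancelled only for nonzero weights;
        a point of weight 0 may lie off the hyperplane, so these cases are separate.\<close>
      consider "u = 0" "v = 1" | "v = 0" "u = 1" | "u \<noteq> 0" "v \<noteq> 0"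
        using uv by force
      then show ?thesis
      proof cases
        case 1
        then show ?thesis using T eq by (simp add: T_def)
      next
        case 2
        then show ?thesis using T eq by (simp add: T_def)
      next
        case 3
        then show ?thesis
          using T eq uv by (intro rat_convexD[OF rat_convex_hull]) (auto simp: T_def)
      qed
    qed
    then show "u *s x + v *s y \<in> T"
      using b le by (simp add: T_def lin_form_combination)
  qed
  moreover have "S \<subseteq> T"
    using assms by (auto simp: T_def intro: hull_inc)
  ultimately have hull_T: "rat_convex hull S \<subseteq> T"
    by (rule hull_minimal[rotated])
  have "rat_convex {x. lin_form c x = b}"
    by (auto simp: rat_convex_def lin_form_combination simp flip: distrib_right)
  then have "rat_convex hull ?F \<subseteq> {x. lin_form c x = b}"
    by (rule hull_minimal[rotated]) auto
  moreover have "rat_convex hull ?F \<subseteq> rat_convex hull S"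
    by (rule hull_mono) auto
  ultimately show "rat_convex hull S \<inter> {x. lin_form c x = b} = rat_convex hull ?F"
    using hull_T by (auto simp: T_def)
  show "rat_convex hull S \<subseteq> {x. b \<le> lin_form c x}"
    using hull_T by (auto simp: T_def)
qed

lemma hull_empty_rat_convex: "rat_convex hull {} = {}"
  by (simp add: hull_unique rat_convex_def)

text \<open>A singleton face is itself the hull of the generators lying on it, and such a hull
  forces these generators to be exactly \<open>x\<close>.\<close>

lemma is_vertex_hullD:
  assumes "is_vertex (rat_convex hull S) x"
  shows "x \<in> S"
proof -
  \<comment> \<open>\<open>S\<close> lies in its hull \<open>{x}\<close>, and it is nonempty because
    the empty set has empty hull.\<close>
  have eq: "S = {x}" if "{x} = rat_convex hull S" for S
    using that hull_subset[of S rat_convex] hull_empty_rat_convex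
    by (metis insert_not_empty subset_singletonD)
  have *: "x \<in> S" if "S \<subseteq> {s. b \<le> lin_form c s}"
    "{x} = rat_convex hull S \<inter> {y. lin_form c y = b}" for b c
  proof -
    have "{x} = rat_convex hull {s \<in> S. lin_form c s = b}"
      using that hull_Int_hyperplane(1)[of S b c] by auto
    from eq[OF this] show ?thesis by auto
  qed
  from assms consider "{x} = rat_convex hull S" |
    H where "supporting_hyperplane (rat_convex hull S) H" "{x} = rat_convex hull S \<inter> H"
    by (auto simp: is_vertex_def is_face_def)
  then show ?thesis
  proof cases
    case 1
    then show ?thesis using eq[of S] by auto
  next
    case 2
    then obtain c b where H: "{x} = rat_convex hull S \<inter> {y. lin_form c y = b}"
      and "rat_convex hull S \<subseteq> {y. lin_form c y \<le> b} \<or> rat_convex hull S \<subseteq> {y. b \<le> lin_form c y}"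
      by (auto simp: supporting_hyperplane_def)
    \<comment> \<open>Negating both \<open>c\<close> and \<open>b\<close> keeps the hyperplane and
      swaps its half-spaces.\<close>
    then consider "S \<subseteq> {s. - b \<le> lin_form (- c) s}" | "S \<subseteq> {s. b \<le> lin_form c s}"
      using hull_subset[of S rat_convex] by (auto simp: lin_form_uminus_left)
    then show ?thesis
    proof cases
      case 1
      then show ?thesis using H by (intro *[of "- b" "- c"]) (auto simp: lin_form_uminus_left)
    next
      case 2
      then show ?thesis using H by (intro *[of b c])
    qed
  qed
qed

lemma is_face_hull_subset:
  assumes "\<And>s. s \<in> S \<Longrightarrow> b \<le> lin_form c s" "F = {s \<in> S. lin_form c s = b}" "F \<noteq> {}"
  shows "is_face (rat_convex hull S) (rat_convex hull F)"
\<comment> \<open>The zero form defines no hyperplane. As \<open>F\<close> is nonempty,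
  \<open>b\<close> is then 0 and the face is the whole hull.\<close>
proof (cases "c = 0")
  case True
  then have "F = S"
    using assms by auto
  then show ?thesis
    by (simp add: is_face_def)
next
  case False
  then have "supporting_hyperplane (rat_convex hull S) {x. lin_form c x = b}"
    using hull_Int_hyperplane(2)[OF assms(1)] by (auto simp: supporting_hyperplane_def)
  moreover have "rat_convex hull F = rat_convex hull S \<inter> {x. lin_form c x = b}"
    using hull_Int_hyperplane(1)[of S b c] assms(1,2) by simp
  ultimately show ?thesis
    unfolding is_face_def by blast
qed

lemma rat_aff_dim_segment:
  assumes "x \<noteq> y"
  shows "rat_aff_dim (rat_convex hull {x, y}) = 1"
proof -
  \<comment> \<open>The line through \<open>x\<close> and \<open>y\<close> is convex, so it contains
    the segment and bounds its directions by the span of \<open>x - y\<close>.\<close>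
  define L where "L = range (\<lambda>t. y + t *s (x - y))"
  let ?E = "rat_convex hull {x, y}"
  let ?D = "{a - b | a b. a \<in> ?E \<and> b \<in> ?E}"
  have "rat_convex L"
    unfolding rat_convex_def
  proof (intro ballI allI impI)
    fix a b and u v :: rat
    assume "a \<in> L" "b \<in> L" and uv: "u + v = 1"
    then obtain s t where "a = y + s *s (x - y)" "b = y + t *s (x - y)"
      by (auto simp: L_def)
    moreover have "v = 1 - u" using uv by simp
    ultimately have "u *s a + v *s b = y + (u * s + v * t) *s (x - y)"
      by (simp only:) (simp add: vec_eq_iff algebra_simps)
    then show "u *s a + v *s b \<in> L"
      by (auto simp: L_def)
  qed
  moreover have "x \<in> L"
    unfolding L_def by (rule image_eqI[of _ _ 1]) auto
  moreover have "y \<in> L"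
    unfolding L_def by (rule image_eqI[of _ _ 0]) auto
  ultimately have "?E \<subseteq> L"
    by (intro hull_minimal) auto
  have "a - b \<in> vec.span {x - y}" if "a \<in> ?E" "b \<in> ?E" for a b
  proof -
    have "a \<in> L" "b \<in> L"
      using that \<open>?E \<subseteq> L\<close> by auto
    then obtain s t where "a = y + s *s (x - y)" "b = y + t *s (x - y)"
      by (auto simp: L_def)
    then have "a - b = (s - t) *s (x - y)"
      by (simp only:) (simp add: vec_eq_iff algebra_simps)
    then show ?thesis
      by (simp add: vec.span_base vec.span_scale)
  qed
  then have "?D \<subseteq> vec.span {x - y}"
    by blast
  moreover have xy: "x \<in> ?E" "y \<in> ?E"
    by (auto intro: hull_inc)
  then have "{x - y} \<subseteq> ?D"
    by blast
  moreover have "vec.independent {x - y}"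
    using assms by simp
  ultimately have "vec.dim ?D = 1"
    by (intro vec.dim_unique[of "{x - y}"]) auto
  then show ?thesis
    using xy by (auto simp: rat_aff_dim_def)
qed

lemma omega_point_nth:
  "omega_point \<rho> $ (i, j, p, q) = (if p = \<rho> i \<and> q = \<rho> j then 1 else 0)"
  by (simp add: omega_point_def)

lemma eq_one_of_two:
  assumes "\<And>i j. (\<tau> i = \<rho> i \<and> \<tau> j = \<rho> j) \<or> (\<tau> i = \<sigma> i \<and> \<tau> j = \<sigma> j)"
  shows "\<tau> = \<rho> \<or> \<tau> = \<sigma>"
  using assms by (metis ext)

lemma is_face_omega_segment:
  "is_face Omega (rat_convex hull {omega_point \<rho>, omega_point \<sigma>})"
proof -
  define c :: "rat ^ ('a \<times> 'a \<times> 2 \<times> 2)" where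
    "c = (\<chi> k. if omega_point \<rho> $ k = 0 \<and> omega_point \<sigma> $ k = 0 then 1 else 0)"
  have nonneg: "0 \<le> c $ k * omega_point \<tau> $ k" for k and \<tau> :: "'a \<Rightarrow> 2"
    by (cases k) (simp add: c_def omega_point_nth)
  have zero: "lin_form c (omega_point \<tau>) = 0 \<longleftrightarrow> \<tau> = \<rho> \<or> \<tau> = \<sigma>" for \<tau>
  proof -
    have "lin_form c (omega_point \<tau>) = 0 \<longleftrightarrow> (\<forall>k. c $ k * omega_point \<tau> $ k = 0)"
      unfolding lin_form_def using nonneg by (simp add: sum_nonneg_eq_0_iff)
    \<comment> \<open>The decisive coordinates are \<open>(i, j, \<tau> i, \<tau> j)\<close>, where
      the point of \<open>\<tau>\<close> is 1: there \<open>c\<close> vanishes iff the point of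
      \<open>\<rho>\<close> or that of \<open>\<sigma>\<close> is 1.\<close>
    also have "\<dots> \<longleftrightarrow> (\<forall>i j. (\<tau> i = \<rho> i \<and> \<tau> j = \<rho> j) \<or> (\<tau> i = \<sigma> i \<and> \<tau> j = \<sigma> j))"
      by (auto simp: c_def omega_point_nth)
    also have "\<dots> \<longleftrightarrow> \<tau> = \<rho> \<or> \<tau> = \<sigma>"
      using eq_one_of_two[of \<tau> \<rho> \<sigma>] by blast
    finally show ?thesis .
  qed
  show ?thesis
    unfolding Omega_def
  proof (rule is_face_hull_subset)
    show "0 \<le> lin_form c s" if "s \<in> range omega_point" for s
      using that nonneg by (auto simp: lin_form_def intro: sum_nonneg)
    show "{omega_point \<rho>, omega_point \<sigma>} = {s \<in> range omega_point. lin_form c s = 0}"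
      using zero by auto
  qed simp
qed

theorem theorem3:
  fixes X Y :: "rat ^ ('n::finite \<times> 'n \<times> 2 \<times> 2)"
  assumes "CARD('n) \<ge> 2"
    and "is_vertex Omega X" and "is_vertex Omega Y" and "X \<noteq> Y"
  shows "is_edge Omega (rat_convex hull {X, Y})"
proof -
  \<comment> \<open>Vertices are generators, which supplies the two functions needed for the
    face.\<close>
  have "X \<in> range omega_point" "Y \<in> range omega_point"
    using assms(2,3) by (auto simp: Omega_def dest: is_vertex_hullD)
  then show ?thesis
    using is_face_omega_segment rat_aff_dim_segment[OF assms(4)] by (auto simp: is_edge_def)
qed

end
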